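(* Let $E$ be a pseudo-effect algebra. Then $E$ admits a two-valued state $s$ if and only if there exists a maximal and normal ideal $I$ of $E$ such that $E=I\cup I^{-}=I\cup I^{\sim}$ and $I\cap I^{-}=I\cap I^{\sim}=\emptyset$.
   Context: A pseudo-effect algebra (PEA) is a structure $(E;+,0,1)$ with a partial binary operation $+$ and constants $0,1$ such that for all $a,b,c\in E$: (PE1) $a+b$ and $(a+b)+c$ exist iff $b+c$ and $a+(b+c)$ exist, and then $(a+b)+c=a+(b+c)$; (PE2) there are exactly one $d\in E$ and exactly one $e\in E$ with $a+d=e+a=1$; (PE3) if $a+b$ exists, there are $d,e\in E$ with $a+b=d+a=b+e$; (PE4) if $a+1$ or $1+a$ exists, then $a=0$. It is assumed that $0\ne1$. Write $a^{\sim}$ for the unique element with $a+a^{\sim}=1$ and $a^{-}$ for the unique element with $a^{-}+a=1$; $I^{-}=\{i^{-}\mid i\in I\}$, $I^{\sim}=\{i^{\sim}\mid i\in I\}$. The order is $a\le b$ iff $a+c=b$ for some $c\in E$ (equivalently $d+a=b$ for some $d\in E$). An ideal of $E$ is a nonempty subset $I$ such that $a\le i\in I$ implies $a\in I$, and $i+j\in I$ whenever $i,j\in I$ and $i+j$ exists. It is proper if $1\notin I$; maximal if it is proper and not properly included in any proper ideal; normal if whenever $a,i,j\in E$ are such that $a+i$ and $j+a$ exist and are equal, we have $i\in I$ iff $j\in I$. A state on $E$ is a map $s:E\to[0,1]$ with $s(0)=0$, $s(1)=1$ and $s(a+b)=s(a)+s(b)$ whenever $a+b$ exists. It is two-valued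 if $s(E)=\{0,1\}$. *)

theory Defs
  imports Complex_Main "HOL-Algebra.Congruence"
begin

text \<open>The partial sum takes values in an option type: \<open>None\<close> means that the sum does not exist.\<close>

record 'a pea = "'a partial_object" +
  psum :: "'a \<Rightarrow> 'a \<Rightarrow> 'a option" (infixl \<open>\<oplus>\<index>\<close> 65)
  pzero :: 'a (\<open>\<zero>\<index>\<close>)
  pone :: 'a (\<open>\<one>\<index>\<close>)

text \<open>In \<open>PE1\<close>, either side is \<open>Some y\<close> precisely if both sums of that bracketing exist and
  the resulting value is \<open>y\<close>; hence the equation says that one bracketing exists iff the other does,
  with equal values.\<close>

locale pseudo_effect_algebra =
  fixes E :: "('a, 'm) pea_scheme" (structure)
  assumes zero_closed: "\<zero> \<in> carrier E"
    and one_closed: "\<one> \<in> carrier E"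
    and sum_closed: "\<lbrakk>a \<in> carrier E; b \<in> carrier E; a \<oplus> b = Some c\<rbrakk> \<Longrightarrow> c \<in> carrier E"
    and PE1: "\<lbrakk>a \<in> carrier E; b \<in> carrier E; c \<in> carrier E\<rbrakk> \<Longrightarrow>
      Option.bind (a \<oplus> b) (\<lambda>x. x \<oplus> c) = Option.bind (b \<oplus> c) (\<lambda>x. a \<oplus> x)"
    and PE2_right: "a \<in> carrier E \<Longrightarrow> \<exists>!d. d \<in> carrier E \<and> a \<oplus> d = Some \<one>"
    and PE2_left: "a \<in> carrier E \<Longrightarrow> \<exists>!e. e \<in> carrier E \<and> e \<oplus> a = Some \<one>"
    and PE3: "\<lbrakk>a \<in> carrier E; b \<in> carrier E; a \<oplus> b \<noteq> None\<rbrakk> \<Longrightarrow>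
      \<exists>d\<in>carrier E. \<exists>e\<in>carrier E. a \<oplus> b = d \<oplus> a \<and> a \<oplus> b = b \<oplus> e"
    and PE4: "\<lbrakk>a \<in> carrier E; a \<oplus> \<one> \<noteq> None \<or> \<one> \<oplus> a \<noteq> None\<rbrakk> \<Longrightarrow> a = \<zero>"
    and zero_neq_one: "\<zero> \<noteq> \<one>"

definition right_compl :: "('a, 'm) pea_scheme \<Rightarrow> 'a \<Rightarrow> 'a"
  where "right_compl E a = (THE d. d \<in> carrier E \<and> a \<oplus>\<^bsub>E\<^esub> d = Some \<one>\<^bsub>E\<^esub>)"

definition left_compl :: "('a, 'm) pea_scheme \<Rightarrow> 'a \<Rightarrow> 'a"
  where "left_compl E a = (THE e. e \<in> carrier E \<and> e \<oplus>\<^bsub>E\<^esub> a = Some \<one>\<^bsub>E\<^esub>)"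

definition pea_le :: "('a, 'm) pea_scheme \<Rightarrow> 'a \<Rightarrow> 'a \<Rightarrow> bool"
  where "pea_le E a b \<longleftrightarrow> (\<exists>c\<in>carrier E. a \<oplus>\<^bsub>E\<^esub> c = Some b)"

definition pea_ideal :: "('a, 'm) pea_scheme \<Rightarrow> 'a set \<Rightarrow> bool"
  where "pea_ideal E I \<longleftrightarrow>
    I \<subseteq> carrier E \<and> I \<noteq> {} \<and>
    (\<forall>a\<in>carrier E. \<forall>i\<in>I. pea_le E a i \<longrightarrow> a \<in> I) \<and>
    (\<forall>i\<in>I. \<forall>j\<in>I. \<forall>k. i \<oplus>\<^bsub>E\<^esub> j = Some k \<longrightarrow> k \<in> I)"

definition proper_ideal :: "('a, 'm) pea_scheme \<Rightarrow> 'a set \<Rightarrow> bool"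
  where "proper_ideal E I \<longleftrightarrow> pea_ideal E I \<and> \<one>\<^bsub>E\<^esub> \<notin> I"

definition maximal_ideal :: "('a, 'm) pea_scheme \<Rightarrow> 'a set \<Rightarrow> bool"
  where "maximal_ideal E I \<longleftrightarrow> proper_ideal E I \<and> \<not> (\<exists>J. proper_ideal E J \<and> I \<subset> J)"

definition normal_ideal :: "('a, 'm) pea_scheme \<Rightarrow> 'a set \<Rightarrow> bool"
  where "normal_ideal E I \<longleftrightarrow> pea_ideal E I \<and>
    (\<forall>a\<in>carrier E. \<forall>i\<in>carrier E. \<forall>j\<in>carrier E.
      a \<oplus>\<^bsub>E\<^esub> i \<noteq> None \<and> j \<oplus>\<^bsub>E\<^esub> a \<noteq> None \<and> a \<oplus>\<^bsub>E\<^esub> i = j \<oplus>\<^bsub>E\<^esub> a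
        \<longrightarrow> (i \<in> I \<longleftrightarrow> j \<in> I))"

definition state :: "('a, 'm) pea_scheme \<Rightarrow> ('a \<Rightarrow> real) \<Rightarrow> bool"
  where "state E s \<longleftrightarrow>
    (\<forall>a\<in>carrier E. s a \<in> {0..1}) \<and> s \<zero>\<^bsub>E\<^esub> = 0 \<and> s \<one>\<^bsub>E\<^esub> = 1 \<and>
    (\<forall>a\<in>carrier E. \<forall>b\<in>carrier E. \<forall>c. a \<oplus>\<^bsub>E\<^esub> b = Some c \<longrightarrow> s c = s a + s b)"

definition two_valued_state :: "('a, 'm) pea_scheme \<Rightarrow> ('a \<Rightarrow> real) \<Rightarrow> bool"
  where "two_valued_state E s \<longleftrightarrow> state E s \<and> s ` carrier E = {0, 1}"

end

theory Submission
  imports Defs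
begin

text \<open>Two-valued states and the ideals in question are in correspondence via \<open>I = s\<^sup>-\<^sup>1(0)\<close>.
  The kernel of a two-valued state is a normal ideal by additivity of the state; it contains exactly
  one of \<open>a\<close>, \<open>a\<^sup>\<sim>\<close> and exactly one of \<open>a\<close>, \<open>a\<^sup>-\<close>, because \<open>s a + s a\<^sup>\<sim> = s a\<^sup>- + s a = 1\<close>.
  This yields the two partitions of the algebra, and also maximality: a larger ideal contains some
  \<open>a\<close> outside the kernel together with \<open>a\<^sup>\<sim>\<close>, hence \<open>1\<close>.

  Conversely, let \<open>s\<close> be \<open>0\<close> on \<open>I\<close> and \<open>1\<close> elsewhere. Both \<open>a\<close> and \<open>b\<close> lie
  below \<open>a + b\<close>, so the only critical case of additivity is \<open>a, b \<notin> I\<close>; such a sum cannot exist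
  (\<open>sum_outside_impossible\<close>). Indeed, \<open>a = i\<^sup>-\<close> for some \<open>i \<in> I\<close>, and if \<open>(a + b) + d = 1\<close>, then
  \<open>a + (b + d) = 1\<close> gives \<open>b + d = a\<^sup>\<sim> = i\<close>, so \<open>b \<le> i\<close> and \<open>b \<in> I\<close>.\<close>

context pseudo_effect_algebra
begin

lemma right_compl: "a \<in> carrier E \<Longrightarrow> right_compl E a \<in> carrier E \<and> a \<oplus> right_compl E a = Some \<one>"
  unfolding right_compl_def by (rule theI') (rule PE2_right)

lemma left_compl: "a \<in> carrier E \<Longrightarrow> left_compl E a \<in> carrier E \<and> left_compl E a \<oplus> a = Some \<one>"
  unfolding left_compl_def by (rule theI') (rule PE2_left)

lemma right_compl_eqI:
  "\<lbrakk>a \<in> carrier E; d \<in> carrier E; a \<oplus> d = Some \<one>\<rbrakk> \<Longrightarrow> right_compl E a = d"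
  using PE2_right right_compl by blast

lemma left_compl_eqI:
  "\<lbrakk>a \<in> carrier E; e \<in> carrier E; e \<oplus> a = Some \<one>\<rbrakk> \<Longrightarrow> left_compl E a = e"
  using PE2_left left_compl by blast

lemma left_right_compl: "a \<in> carrier E \<Longrightarrow> left_compl E (right_compl E a) = a"
  using right_compl left_compl_eqI by blast

lemma right_left_compl: "a \<in> carrier E \<Longrightarrow> right_compl E (left_compl E a) = a"
  using left_compl right_compl_eqI by blast

lemma zero_left:
  assumes "a \<in> carrier E" shows "\<zero> \<oplus> a = Some a"
proof -
  have "left_compl E \<one> = \<zero>"
    using left_compl[OF one_closed] PE4[of "left_compl E \<one>"] by simp
  then have z1: "\<zero> \<oplus> \<one> = Some \<one>"
    using left_compl[OF one_closed] by simp
  define b where "b = right_compl E a"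
  have b: "b \<in> carrier E" "a \<oplus> b = Some \<one>"
    using right_compl[OF assms] by (auto simp: b_def)
  \<comment> \<open>Since \<open>0 + (a + b) = 0 + 1 = 1\<close>, both \<open>0 + a\<close> and \<open>a\<close> are the left complement of \<open>b\<close>.\<close>
  have "Option.bind (\<zero> \<oplus> a) (\<lambda>x. x \<oplus> b) = Some \<one>"
    using PE1[OF zero_closed assms b(1)] b(2) z1 by simp
  then obtain x where x: "\<zero> \<oplus> a = Some x" "x \<oplus> b = Some \<one>"
    by (auto simp: bind_eq_Some_conv)
  have "x \<in> carrier E"
    using x(1) sum_closed zero_closed assms by blast
  then have "x = a"
    using PE2_left[OF b(1)] b(2) x(2) assms by blast
  with x show ?thesis by simp
qed

lemma pea_le_sum_left: "\<lbrakk>b \<in> carrier E; a \<oplus> b = Some c\<rbrakk> \<Longrightarrow> pea_le E a c"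
  by (auto simp: pea_le_def)

lemma pea_le_sum_right:
  assumes "a \<in> carrier E" "b \<in> carrier E" "a \<oplus> b = Some c" shows "pea_le E b c"
proof -
  obtain e where "e \<in> carrier E" "a \<oplus> b = b \<oplus> e"
    using PE3[OF assms(1,2)] assms(3) by blast
  with assms(3) show ?thesis by (auto simp: pea_le_def)
qed

lemma ideal_subset: "pea_ideal E I \<Longrightarrow> I \<subseteq> carrier E"
  by (simp add: pea_ideal_def)

lemma ideal_down: "\<lbrakk>pea_ideal E I; a \<in> carrier E; i \<in> I; pea_le E a i\<rbrakk> \<Longrightarrow> a \<in> I"
  unfolding pea_ideal_def by blast

lemma ideal_sum: "\<lbrakk>pea_ideal E I; i \<in> I; j \<in> I; i \<oplus> j = Some k\<rbrakk> \<Longrightarrow> k \<in> I"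
  unfolding pea_ideal_def by blast

lemma zero_in_ideal:
  assumes "pea_ideal E I" shows "\<zero> \<in> I"
proof -
  obtain i where i: "i \<in> I"
    using assms unfolding pea_ideal_def by blast
  then have "i \<in> carrier E"
    using ideal_subset[OF assms] by blast
  then have "pea_le E \<zero> i"
    using pea_le_sum_left zero_left by simp
  with i show ?thesis
    by (rule ideal_down[OF assms zero_closed])
qed

lemma sum_outside_impossible:
  assumes I: "pea_ideal E I" and cover: "carrier E = I \<union> left_compl E ` I"
    and a: "a \<in> carrier E" "a \<notin> I" and b: "b \<in> carrier E" "b \<notin> I"
  shows "a \<oplus> b = None"
proof (rule ccontr)
  assume "a \<oplus> b \<noteq> None"
  then obtain c where c: "a \<oplus> b = Some c" by auto
  then have "c \<in> carrier E" using sum_closed a b by blast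
  then obtain d where d: "d \<in> carrier E" "c \<oplus> d = Some \<one>"
    using right_compl by blast
  have "Option.bind (b \<oplus> d) (\<lambda>x. a \<oplus> x) = Some \<one>"
    using PE1[OF a(1) b(1) d(1)] c d(2) by simp
  then obtain x where x: "b \<oplus> d = Some x" "a \<oplus> x = Some \<one>"
    by (auto simp: bind_eq_Some_conv)
  have "x \<in> carrier E" using x(1) sum_closed b d by blast
  then have "x = right_compl E a"
    using right_compl_eqI a(1) x(2) by simp
  moreover obtain i where i: "i \<in> I" "a = left_compl E i"
    using a cover by blast
  ultimately have "x \<in> I"
    using right_left_compl ideal_subset[OF I] by auto
  then show False
    using ideal_down[OF I b(1)] pea_le_sum_left[OF d(1) x(1)] b(2) by blast
qed

lemma state_indicator:
  assumes I: "proper_ideal E I" and cover: "carrier E = I \<union> left_compl E ` I"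
  shows "two_valued_state E (\<lambda>a. if a \<in> I then 0 else 1)"
proof -
  have pI: "pea_ideal E I" and one: "\<one> \<notin> I"
    using I by (auto simp: proper_ideal_def)
  let ?s = "\<lambda>a. if a \<in> I then 0 else (1::real)"
  have additive: "?s c = ?s a + ?s b"
    if a: "a \<in> carrier E" and b: "b \<in> carrier E" and c: "a \<oplus> b = Some c" for a b c
  proof -
    have "c \<in> I \<longleftrightarrow> a \<in> I \<and> b \<in> I"
      using ideal_sum[OF pI _ _ c] ideal_down[OF pI a _ pea_le_sum_left[OF b c]]
        ideal_down[OF pI b _ pea_le_sum_right[OF a b c]] by blast
    moreover have "a \<in> I \<or> b \<in> I"
      using sum_outside_impossible[OF pI cover a _ b] c by force
    ultimately show ?thesis by auto
  qed
  have "?s ` carrier E = {0, 1}"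
  proof
    show "{0, 1} \<subseteq> ?s ` carrier E"
      using zero_in_ideal[OF pI] one
        image_eqI[of 0 ?s, OF _ zero_closed] image_eqI[of 1 ?s, OF _ one_closed] by simp
  qed auto
  then show ?thesis
    using additive zero_in_ideal[OF pI] one
    by (simp add: two_valued_state_def state_def)
qed

context
  fixes s
  assumes s: "two_valued_state E s"
begin

text \<open>The kernel of the two-valued state \<open>s\<close>.\<close>
definition state_kernel :: "'a set"
  where "state_kernel = {a \<in> carrier E. s a = 0}"

lemma state_sum:
  "\<lbrakk>a \<in> carrier E; b \<in> carrier E; a \<oplus> b = Some c\<rbrakk> \<Longrightarrow> s c = s a + s b"
  using s unfolding two_valued_state_def state_def by blast

lemma state_zero: "s \<zero> = 0" and state_one: "s \<one> = 1"
  using s unfolding two_valued_state_def state_def by blast+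

lemma state_nonneg: "a \<in> carrier E \<Longrightarrow> 0 \<le> s a"
  using s by (auto simp: two_valued_state_def state_def)

lemma state_cases: "a \<in> carrier E \<Longrightarrow> s a = 0 \<or> s a = 1"
  using s unfolding two_valued_state_def by blast

lemma state_right_compl: "a \<in> carrier E \<Longrightarrow> s (right_compl E a) = 1 - s a"
  using right_compl[of a] state_sum[of a "right_compl E a" "\<one>"] state_one by simp

lemma state_left_compl: "a \<in> carrier E \<Longrightarrow> s (left_compl E a) = 1 - s a"
  using left_compl[of a] state_sum[of "left_compl E a" a "\<one>"] state_one by simp

lemma right_compl_in_kernel:
  "\<lbrakk>a \<in> carrier E; a \<notin> state_kernel\<rbrakk> \<Longrightarrow> right_compl E a \<in> state_kernel"
  using state_cases[of a] state_right_compl[of a] right_compl[of a] by (simp add: state_kernel_def)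

lemma left_compl_in_kernel:
  "\<lbrakk>a \<in> carrier E; a \<notin> state_kernel\<rbrakk> \<Longrightarrow> left_compl E a \<in> state_kernel"
  using state_cases[of a] state_left_compl[of a] left_compl[of a] by (simp add: state_kernel_def)

lemma ideal_state_kernel: "pea_ideal E state_kernel"
  unfolding pea_ideal_def
proof (intro conjI ballI allI impI)
  show "state_kernel \<subseteq> carrier E" "state_kernel \<noteq> {}"
    using zero_closed state_zero by (auto simp: state_kernel_def)
next
  fix a i assume a: "a \<in> carrier E" and i: "i \<in> state_kernel" and le: "pea_le E a i"
  obtain c where c: "c \<in> carrier E" "a \<oplus> c = Some i"
    using le by (auto simp: pea_le_def)
  then have "s i = s a + s c" using state_sum a by blast
  then show "a \<in> state_kernel"
    using state_nonneg[OF a] state_nonneg[OF c(1)] i a by (simp add: state_kernel_def)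
next
  fix i j k assume "i \<in> state_kernel" "j \<in> state_kernel" "i \<oplus> j = Some k"
  then show "k \<in> state_kernel"
    using state_sum[of i j k] sum_closed[of i j k] by (simp add: state_kernel_def)
qed

lemma maximal_state_kernel: "maximal_ideal E state_kernel"
  unfolding maximal_ideal_def
proof (intro conjI notI)
  show "proper_ideal E state_kernel"
    using ideal_state_kernel state_one by (simp add: proper_ideal_def state_kernel_def)
next
  assume "\<exists>J. proper_ideal E J \<and> state_kernel \<subset> J"
  then obtain J a where J: "pea_ideal E J" "\<one> \<notin> J" "state_kernel \<subseteq> J"
    and a: "a \<in> J" "a \<notin> state_kernel"
    by (auto simp: proper_ideal_def)
  have aE: "a \<in> carrier E" using ideal_subset J(1) a(1) by blast
  then have "right_compl E a \<in> J"
    using right_compl_in_kernel a(2) J(3) by blast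
  then show False
    using ideal_sum[OF J(1) a(1)] right_compl[OF aE] J(2) by blast
qed

lemma normal_state_kernel: "normal_ideal E state_kernel"
  unfolding normal_ideal_def
proof (intro conjI ballI impI ideal_state_kernel)
  fix a i j assume E: "a \<in> carrier E" "i \<in> carrier E" "j \<in> carrier E"
    and eq: "a \<oplus> i \<noteq> None \<and> j \<oplus> a \<noteq> None \<and> a \<oplus> i = j \<oplus> a"
  then obtain c where "a \<oplus> i = Some c" "j \<oplus> a = Some c" by auto
  then have "s a + s i = s j + s a" using state_sum E by metis
  then show "i \<in> state_kernel \<longleftrightarrow> j \<in> state_kernel"
    using E by (simp add: state_kernel_def)
qed

lemma kernel_partition_left:
  "carrier E = state_kernel \<union> left_compl E ` state_kernel"
  "state_kernel \<inter> left_compl E ` state_kernel = {}"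
proof -
  have "a \<in> left_compl E ` state_kernel" if "a \<in> carrier E" "a \<notin> state_kernel" for a
    using right_compl_in_kernel[OF that] left_right_compl[OF that(1)] by (metis imageI)
  then show "carrier E = state_kernel \<union> left_compl E ` state_kernel"
    using left_compl by (auto simp: state_kernel_def)
  show "state_kernel \<inter> left_compl E ` state_kernel = {}"
    using state_left_compl by (auto simp: state_kernel_def)
qed

lemma kernel_partition_right:
  "carrier E = state_kernel \<union> right_compl E ` state_kernel"
  "state_kernel \<inter> right_compl E ` state_kernel = {}"
proof -
  have "a \<in> right_compl E ` state_kernel" if "a \<in> carrier E" "a \<notin> state_kernel" for a
    using left_compl_in_kernel[OF that] right_left_compl[OF that(1)] by (metis imageI)
  then show "carrier E = state_kernel \<union> right_compl E ` state_kernel"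
    using right_compl by (auto simp: state_kernel_def)
  show "state_kernel \<inter> right_compl E ` state_kernel = {}"
    using state_right_compl by (auto simp: state_kernel_def)
qed

end

end

theorem theorem3p3:
  fixes E :: "('a, 'm) pea_scheme"
  assumes "pseudo_effect_algebra E"
  shows "(\<exists>s. two_valued_state E s) \<longleftrightarrow>
    (\<exists>I. maximal_ideal E I \<and> normal_ideal E I \<and>
      carrier E = I \<union> left_compl E ` I \<and> carrier E = I \<union> right_compl E ` I \<and>
      I \<inter> left_compl E ` I = {} \<and> I \<inter> right_compl E ` I = {})"
proof -
  interpret pseudo_effect_algebra E by fact
  show ?thesis
  proof
    assume "\<exists>s. two_valued_state E s"
    then obtain s where s: "two_valued_state E s" ..
    note kernel = maximal_state_kernel[OF s] normal_state_kernel[OF s]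
      kernel_partition_left[OF s] kernel_partition_right[OF s]
    show "\<exists>I. maximal_ideal E I \<and> normal_ideal E I \<and>
      carrier E = I \<union> left_compl E ` I \<and> carrier E = I \<union> right_compl E ` I \<and>
      I \<inter> left_compl E ` I = {} \<and> I \<inter> right_compl E ` I = {}"
      by (rule exI[of _ "state_kernel s"]) (intro conjI kernel)
  next
    assume "\<exists>I. maximal_ideal E I \<and> normal_ideal E I \<and>
      carrier E = I \<union> left_compl E ` I \<and> carrier E = I \<union> right_compl E ` I \<and>
      I \<inter> left_compl E ` I = {} \<and> I \<inter> right_compl E ` I = {}"
    then obtain I where I: "maximal_ideal E I" "carrier E = I \<union> left_compl E ` I"
      by (elim exE conjE)
    have "proper_ideal E I"
      using I(1) by (simp add: maximal_ideal_def)
    then show "\<exists>s. two_valued_state E s"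
      by (intro exI) (rule state_indicator[OF _ I(2)])
  qed
qed

end
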